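(* Let $\mathbb{F}$ be a finite field and let $k\ge 1$. If there exists a $(k+2,k,4)$-MSR code over $\mathbb{F}$, then $k\le 7$.
   Context: Let $\mathbb{F}$ be a field and let $n>k\ge 1$, $\ell\ge 1$ be integers. An $(n,k,\ell)$-MDS code over $\mathbb{F}$ is an $\mathbb{F}$-linear subspace $\mathcal{C}\subseteq(\mathbb{F}^\ell)^n$ of $\mathbb{F}$-dimension $k\ell$ such that every codeword $c=(c_1,\dots,c_n)\in\mathcal{C}$ (with each entry $c_i\in\mathbb{F}^\ell$) is determined by any $k$ of its $n$ entries. Put $r=n-k$ and assume $r$ divides $\ell$. An $(n,k,\ell)$-MSR (minimum storage regenerating) code is an $(n,k,\ell)$-MDS code $\mathcal{C}$ such that for every $m\in\{1,\dots,k\}$ there exist $\mathbb{F}$-linear maps $h_{i,m}:\mathbb{F}^\ell\to\mathbb{F}^{\ell/r}$ for $i\in\{1,\dots,n\}\setminus\{m\}$ such that, for all $c\in\mathcal{C}$, the entry $c_m$ can be computed by an $\mathbb{F}$-linear map (depending only on $m$ and $\mathcal{C}$) from the vector $(h_{i,m}(c_i))_{i\ne m}\in\mathbb{F}^{(n-1)\ell/r}$. *)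

theory Defs
  imports Complex_Main "HOL-Library.Function_Algebras"
begin

text \<open>
  A vector of \<open>F ^ l\<close> is a function on \<open>nat\<close> that is \<open>0\<close> outside \<open>{1..l}\<close>, and a tuple of such
  vectors indexed by a set \<open>I\<close> of positions is a function on \<open>nat\<close> that is \<open>0\<close> outside \<open>I\<close>.
  Addition and zero are the pointwise ones of \<open>Function_Algebras\<close>; scalar multiplication is below.
\<close>

definition vec_scale :: "'a::field \<Rightarrow> (nat \<Rightarrow> 'a) \<Rightarrow> nat \<Rightarrow> 'a" where
  "vec_scale a v = (\<lambda>j. a * v j)"

definition tuple_scale :: "'a::field \<Rightarrow> (nat \<Rightarrow> nat \<Rightarrow> 'a) \<Rightarrow> nat \<Rightarrow> nat \<Rightarrow> 'a" where
  "tuple_scale a c = (\<lambda>i. vec_scale a (c i))"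

interpretation tuple: vector_space "tuple_scale :: 'a::field \<Rightarrow> _"
  by unfold_locales (auto simp: tuple_scale_def vec_scale_def fun_eq_iff algebra_simps)

definition coord_space :: "nat \<Rightarrow> (nat \<Rightarrow> 'a::field) set" where
  "coord_space l = {v. \<forall>j. j \<notin> {1..l} \<longrightarrow> v j = 0}"

definition tuple_space :: "nat set \<Rightarrow> nat \<Rightarrow> (nat \<Rightarrow> nat \<Rightarrow> 'a::field) set" where
  "tuple_space I l = {c. (\<forall>i\<in>I. c i \<in> coord_space l) \<and> (\<forall>i. i \<notin> I \<longrightarrow> c i = 0)}"

text \<open>
  Linearity is required on \<open>V\<close> only; \<open>Vector_Spaces.linear\<close> would speak about the whole type.
\<close>

definition linear_map_on ::
  "('f \<Rightarrow> 'v::ab_group_add \<Rightarrow> 'v) \<Rightarrow> ('f \<Rightarrow> 'w::ab_group_add \<Rightarrow> 'w) \<Rightarrow>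
     'v set \<Rightarrow> 'w set \<Rightarrow> ('v \<Rightarrow> 'w) \<Rightarrow> bool" where
  "linear_map_on s t V W f \<longleftrightarrow>
     (\<forall>x\<in>V. f x \<in> W) \<and>
     (\<forall>x\<in>V. \<forall>y\<in>V. f (x + y) = f x + f y) \<and>
     (\<forall>a. \<forall>x\<in>V. f (s a x) = t a (f x))"

definition is_MDS_code :: "nat \<Rightarrow> nat \<Rightarrow> nat \<Rightarrow> (nat \<Rightarrow> nat \<Rightarrow> 'a::field) set \<Rightarrow> bool" where
  "is_MDS_code n k l C \<longleftrightarrow>
     1 \<le> k \<and> k < n \<and> 1 \<le> l \<and>
     C \<subseteq> tuple_space {1..n} l \<and> tuple.subspace C \<and> tuple.dim C = k * l \<and>
     (\<forall>S. S \<subseteq> {1..n} \<and> card S = k \<longrightarrow>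
       (\<forall>c\<in>C. \<forall>d\<in>C. (\<forall>i\<in>S. c i = d i) \<longrightarrow> c = d))"

text \<open>
  The vector of \<open>F ^ ((n - 1) * l / r)\<close> downloaded for the repair of entry \<open>m\<close> is kept as a tuple
  of \<open>n - 1\<close> blocks from \<open>F ^ (l / r)\<close>, at the positions \<open>{1..n} - {m}\<close>.
\<close>

definition is_MSR_code :: "nat \<Rightarrow> nat \<Rightarrow> nat \<Rightarrow> (nat \<Rightarrow> nat \<Rightarrow> 'a::field) set \<Rightarrow> bool" where
  "is_MSR_code n k l C \<longleftrightarrow>
     is_MDS_code n k l C \<and> (n - k) dvd l \<and>
     (\<forall>m\<in>{1..k}. \<exists>h :: nat \<Rightarrow> (nat \<Rightarrow> 'a) \<Rightarrow> (nat \<Rightarrow> 'a).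
       (\<forall>i\<in>{1..n} - {m}.
          linear_map_on vec_scale vec_scale (coord_space l) (coord_space (l div (n - k))) (h i)) \<and>
       (\<exists>g. linear_map_on tuple_scale vec_scale
              (tuple_space ({1..n} - {m}) (l div (n - k))) (coord_space l) g \<and>
          (\<forall>c\<in>C. c m = g (\<lambda>i. if i \<in> {1..n} - {m} then h i (c i) else 0))))"

end

theory Submission
  imports Defs "HOL-Analysis.Cartesian_Space"
begin

text \<open>
  Write \<open>F\<close> for the field. Since the code is MDS, prescribing \<open>c\<^sub>k\<^sub>+\<^sub>1 = a\<close> and letting all entries
  in \<open>{1..k} - {i}\<close> vanish determines a codeword. Its entry \<open>c\<^sub>k\<^sub>+\<^sub>2\<close> is \<open>\<phi>\<^sub>i a\<close> for an isomorphism
  \<open>\<phi>\<^sub>i\<close> of \<open>F\<^sup>4\<close>. Fix the entry \<open>m\<close> to be repaired and let \<open>P\<^sub>m\<close> and \<open>R\<^sub>m\<close> be the kernels of the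
  two maps applied to the entries \<open>k + 1\<close> and \<open>k + 2\<close>. A codeword whose downloads all vanish
  has \<open>c\<^sub>m = 0\<close>; as each download has only half the size of an entry, this is restrictive enough to
  force \<open>dim P\<^sub>m = 2\<close>, \<open>\<phi>\<^sub>i P\<^sub>m = R\<^sub>m\<close> for \<open>i \<noteq> m\<close>, and \<open>\<phi>\<^sub>m P\<^sub>m \<inter> R\<^sub>m = 0\<close> (interference alignment,
  \<open>repair_subspaces\<close>). With \<open>\<phi>\<^sub>k\<close> as reference, the maps \<open>A\<^sub>i = \<phi>\<^sub>k\<inverse> \<phi>\<^sub>i\<close> for \<open>i < k\<close> therefore satisfy
  \<open>A\<^sub>i P\<^sub>m \<subseteq> P\<^sub>m\<close> for \<open>i \<noteq> m\<close>, while \<open>A\<^sub>m\<close> moves every nonzero vector of \<open>P\<^sub>m\<close> out of \<open>P\<^sub>m\<close>.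

  It remains to see that at most six planes \<open>H\<^sub>i\<close> of \<open>F\<^sup>4\<close> can carry such maps \<open>A\<^sub>i\<close>
  (\<open>MSR_family_card_le_6\<close>); then \<open>k - 1 \<le> 6\<close>. Think of the planes as lines of projective
  3-space, and say that a map fixes a subspace if it maps it into itself.

  \<^item> Three of them never meet pairwise. Otherwise they pass through one point or lie in one
    hyperplane. This point or hyperplane is determined by the first two and hence fixed by the map of
    the third, which thus cannot move the third plane off itself (\<open>not_pairwise_meeting\<close>).

  \<^item> If there are at least seven planes, then three of them are never pairwise skew. The
    endomorphisms fixing three pairwise skew planes form an algebra isomorphic to the 2 by 2
    matrices, of dimension 4. It contains the identity and the maps of the remaining planes, which are
    at least five elements; but a linear relation between them would let some \<open>A\<^sub>j\<close> fix \<open>H\<^sub>j\<close>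
    (\<open>not_pairwise_skew\<close>).

  Among any six planes three meet pairwise or three are pairwise skew, by the bound
  \<open>R(3,3) \<le> 6\<close> for the Ramsey number. So seven planes are impossible.
\<close>

section \<open>Planes in four-dimensional space\<close>

abbreviation linear_endo :: "('f::field \<Rightarrow> 'v::ab_group_add \<Rightarrow> 'v) \<Rightarrow> ('v \<Rightarrow> 'v) \<Rightarrow> bool" where
  "linear_endo s \<equiv> Vector_Spaces.linear s s"

context finite_dimensional_vector_space
begin

text \<open>
  Independence in \<^locale>\<open>vector_space\<close> is a property of sets of vectors. The family \<open>w\<close> here may
  repeat vectors, and a repetition is itself a relation.
\<close>

lemma nontrivial_relation:
  fixes w :: "'i \<Rightarrow> 'b"
  assumes "finite J" and "card J > dimension"
  obtains x where "\<exists>j\<in>J. x j \<noteq> 0" and "(\<Sum>j\<in>J. scale (x j) (w j)) = 0"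
proof (cases "inj_on w J")
  case True
  have "dependent (w ` J)"
    using dependent_biggerset_general[of "w ` J"] assms dim_subset_UNIV[of "w ` J"]
    by (simp add: card_image[OF True])
  then obtain y where "\<exists>v\<in>w ` J. y v \<noteq> 0" and y: "(\<Sum>v\<in>w ` J. scale (y v) v) = 0"
    using dependent_finite[of "w ` J"] \<open>finite J\<close> by auto
  moreover have "(\<Sum>j\<in>J. scale (y (w j)) (w j)) = 0"
    using y by (simp add: sum.reindex[OF True])
  ultimately show ?thesis using that[of "y \<circ> w"] by auto
next
  case False
  then obtain i j where ij: "i \<in> J" "j \<in> J" "w i = w j" "i \<noteq> j"
    unfolding inj_on_def by blast
  let ?x = "\<lambda>l. (if l = i then 1 else 0) - (if l = j then 1 else 0)"
  have "scale (?x l) (w l) = (if l = i then w l else 0) - (if l = j then w l else 0)" for l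
    using ij by (auto simp: scale_left_diff_distrib)
  then have "(\<Sum>l\<in>J. scale (?x l) (w l)) = 0"
    using ij \<open>finite J\<close> by (simp add: sum_subtractf)
  then show ?thesis using that[of ?x] ij by force
qed

lemma complement_decomposition:
  assumes "subspace S" "subspace T" "S \<inter> T = {0}" "dim S + dim T \<ge> dimension"
  obtains x y where "x \<in> S" "y \<in> T" "v = x + y"
proof -
  let ?U = "{x + y |x y. x \<in> S \<and> y \<in> T}"
  have "dim ?U = dim S + dim T"
    using dim_sums_Int[OF assms(1,2)] assms(3) by simp
  then have "dim ?U \<ge> dim (UNIV :: 'b set)" using assms(4) by (simp add: dimension_def)
  then have "?U = UNIV"
    using subspace_dim_equal[OF subspace_sums[OF assms(1,2)] subspace_UNIV] by auto
  then show ?thesis using that by blast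
qed

text \<open>
  Three pairwise meeting lines of a projective space are concurrent or coplanar. A map fixing the
  first two also fixes their common point and the plane that they span. In the first case it fixes a
  point of the third line; in the second case it keeps the third line inside a fixed projective plane,
  where any two lines meet. In both cases the third line is not moved off itself.
\<close>

lemma not_pairwise_meeting:
  assumes sub: "subspace H\<^sub>1" "subspace H\<^sub>2" "subspace H\<^sub>3"
    and dim: "dim H\<^sub>1 = 2" "dim H\<^sub>2 = 2" "dim H\<^sub>3 = 2" and "H\<^sub>1 \<noteq> H\<^sub>2"
    and A: "linear_endo scale A" "A ` H\<^sub>1 \<subseteq> H\<^sub>1" "A ` H\<^sub>2 \<subseteq> H\<^sub>2"
    and moved: "\<And>v. v \<in> H\<^sub>3 \<Longrightarrow> A v \<in> H\<^sub>3 \<Longrightarrow> v = 0"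
    and meet: "H\<^sub>1 \<inter> H\<^sub>2 \<noteq> {0}" "H\<^sub>1 \<inter> H\<^sub>3 \<noteq> {0}" "H\<^sub>2 \<inter> H\<^sub>3 \<noteq> {0}"
  shows False
proof -
  interpret A: Vector_Spaces.linear scale scale A by fact
  interpret pair: finite_dimensional_vector_space_pair scale Basis scale Basis ..
  have nonzero: "\<exists>v. v \<in> S \<inter> T \<and> v \<noteq> 0"
    if "subspace S" "subspace T" "S \<inter> T \<noteq> {0}" for S T
    using that subspace_0 by blast
  obtain q where q: "q \<in> H\<^sub>1" "q \<in> H\<^sub>3" "q \<noteq> 0" using nonzero[OF sub(1,3) meet(2)] by blast
  obtain s where s: "s \<in> H\<^sub>2" "s \<in> H\<^sub>3" "s \<noteq> 0" using nonzero[OF sub(2,3) meet(3)] by blast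
  let ?W = "{x + y |x y. x \<in> H\<^sub>1 \<and> y \<in> H\<^sub>2}"
  have subI: "subspace (H\<^sub>1 \<inter> H\<^sub>2)" by (simp add: sub subspace_inter)
  have subW: "subspace ?W" by (intro subspace_sums sub)
  have "dim (H\<^sub>1 \<inter> H\<^sub>2) \<noteq> 2"
    using subspace_dim_equal[OF subI sub(1)] subspace_dim_equal[OF subI sub(2)] dim \<open>H\<^sub>1 \<noteq> H\<^sub>2\<close>
    by auto
  moreover have "dim (H\<^sub>1 \<inter> H\<^sub>2) \<le> 2" using dim_subset[of "H\<^sub>1 \<inter> H\<^sub>2" H\<^sub>1] dim by auto
  moreover have "dim (H\<^sub>1 \<inter> H\<^sub>2) \<noteq> 0" using nonzero[OF sub(1,2) meet(1)] by auto
  ultimately have dimI: "dim (H\<^sub>1 \<inter> H\<^sub>2) = 1" by linarith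
  then have dimW: "dim ?W = 3" using dim_sums_Int[OF sub(1,2)] dim by simp
  show False
  proof (cases "q \<in> H\<^sub>2")
    case True
    \<comment> \<open>The planes share the line spanned by \<open>q\<close>, and \<open>A\<close> fixes that line.\<close>
    have "span {q} = H\<^sub>1 \<inter> H\<^sub>2"
    proof (rule subspace_dim_equal[OF subspace_span subI])
      show "span {q} \<subseteq> H\<^sub>1 \<inter> H\<^sub>2" using q True by (intro span_minimal subI) auto
    qed (use q dimI in simp)
    moreover have "A q \<in> H\<^sub>1 \<inter> H\<^sub>2" using A q True by blast
    ultimately have "A q \<in> H\<^sub>3" using span_minimal[of "{q}" H\<^sub>3] q sub(3) by auto
    then show False using moved q by blast
  next
    case False
    \<comment> \<open>The planes lie in the three-dimensional space \<open>W = H\<^sub>1 + H\<^sub>2\<close>, and \<open>A\<close> fixes \<open>W\<close>.\<close>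
    have "q \<notin> span {s}" using span_minimal[of "{s}" H\<^sub>2] s(1) sub(2) False by blast
    then have "independent {q, s}" using s independent_insertI[of q "{s}"] by simp
    moreover have "card {q, s} = 2" using False s by (cases "q = s") auto
    ultimately have "H\<^sub>3 \<subseteq> span {q, s}"
      using card_eq_dim[of "{q, s}" H\<^sub>3] q s dim by auto
    moreover have "{q, s} \<subseteq> ?W"
    proof -
      have "q + 0 \<in> ?W" "0 + s \<in> ?W" using q s sub subspace_0 by blast+
      then show ?thesis by simp
    qed
    ultimately have H3W: "H\<^sub>3 \<subseteq> ?W" using span_minimal[OF _ subW] by blast
    have AW: "A ` ?W \<subseteq> ?W" using A by (force simp: A.add)
    have inj: "inj_on A H\<^sub>3"
      using moved sub(3) subspace_0 by (simp add: A.inj_on_iff_eq_0)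
    have subA: "subspace (A ` H\<^sub>3)" using A.subspace_image sub(3) by blast
    have "dim (A ` H\<^sub>3) = 2"
      using pair.dim_image_eq[OF A(1), of H\<^sub>3] inj span_eq_iff[THEN iffD2, OF sub(3)] dim by simp
    moreover have "H\<^sub>3 \<inter> A ` H\<^sub>3 = {0}" using moved subspace_0[OF sub(3)] subspace_0[OF subA] A.zero by blast
    ultimately have "dim {x + y |x y. x \<in> H\<^sub>3 \<and> y \<in> A ` H\<^sub>3} = 4"
      using dim_sums_Int[OF sub(3) subA] dim by simp
    moreover have "{x + y |x y. x \<in> H\<^sub>3 \<and> y \<in> A ` H\<^sub>3} \<subseteq> ?W"
    proof -
      have "x + y \<in> ?W" if "x \<in> H\<^sub>3" "y \<in> A ` H\<^sub>3" for x y
        using that H3W AW by (intro subspace_add[OF subW]) blast+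
      then show ?thesis by blast
    qed
    ultimately show False using dim_subset[of "{x + y |x y. x \<in> H\<^sub>3 \<and> y \<in> A ` H\<^sub>3}" ?W] dimW by simp
  qed
qed

text \<open>
  Let \<open>\<sigma>\<close> be the isomorphism from \<open>H\<^sub>1\<close> to \<open>H\<^sub>2\<close> whose graph is \<open>H\<^sub>3\<close>. A map that fixes the three planes
  commutes with \<open>\<sigma>\<close>, so it is determined by its restriction to \<open>H\<^sub>1\<close>, which can be any of the
  2 by 2 matrices. For a basis \<open>e\<^sub>1, e\<^sub>2\<close> of \<open>H\<^sub>1\<close> the single vector \<open>u = e\<^sub>1 + \<sigma> e\<^sub>2\<close> records both
  columns at once, because its image has the components \<open>A e\<^sub>1\<close> and \<open>\<sigma> (A e\<^sub>2)\<close>. Evaluation at \<open>u\<close> thus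
  identifies the algebra of these maps with the four-dimensional space itself.
\<close>

lemma separating_vector:
  assumes "dimension = 4"
    and sub: "subspace H\<^sub>1" "subspace H\<^sub>2" "subspace H\<^sub>3"
    and dim: "dim H\<^sub>1 = 2" "dim H\<^sub>2 = 2" "dim H\<^sub>3 = 2"
    and skew: "H\<^sub>1 \<inter> H\<^sub>2 = {0}" "H\<^sub>1 \<inter> H\<^sub>3 = {0}" "H\<^sub>2 \<inter> H\<^sub>3 = {0}"
  obtains u where "\<And>A v. \<lbrakk>linear_endo scale A; A ` H\<^sub>1 \<subseteq> H\<^sub>1; A ` H\<^sub>2 \<subseteq> H\<^sub>2; A ` H\<^sub>3 \<subseteq> H\<^sub>3; A u = 0\<rbrakk> \<Longrightarrow> A v = 0"
proof -
  obtain B where B: "B \<subseteq> H\<^sub>1" "independent B" "H\<^sub>1 \<subseteq> span B" "card B = 2"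
    using basis_exists[of H\<^sub>1] dim by metis
  then obtain e\<^sub>1 e\<^sub>2 where e: "B = {e\<^sub>1, e\<^sub>2}" by (meson card_2_iff)
  obtain w f' where wf: "w \<in> H\<^sub>3" "f' \<in> H\<^sub>2" "e\<^sub>2 = w + f'"
    using complement_decomposition[OF sub(3,2), of e\<^sub>2] skew dim assms(1) by (auto simp: Int_commute)
  (* Here e_2 - f' = w lies in H_3, so that - f' is the vector \<sigma> e_2. *)
  show ?thesis
  proof (rule that[of "e\<^sub>1 - f'"])
    fix A v
    assume A: "linear_endo scale A" "A ` H\<^sub>1 \<subseteq> H\<^sub>1" "A ` H\<^sub>2 \<subseteq> H\<^sub>2" "A ` H\<^sub>3 \<subseteq> H\<^sub>3" and "A (e\<^sub>1 - f') = 0"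
    interpret A: Vector_Spaces.linear scale scale A by fact
    have eq: "A e\<^sub>1 = A f'" using \<open>A (e\<^sub>1 - f') = 0\<close> by (simp add: A.diff)
    have "A e\<^sub>1 \<in> H\<^sub>1" "A f' \<in> H\<^sub>2" "A e\<^sub>2 \<in> H\<^sub>1" "A w \<in> H\<^sub>3" using A B e wf by auto
    then have z: "A e\<^sub>1 = 0" "A f' = 0" using eq skew(1) by auto
    then have "A e\<^sub>2 = A w" using wf by (simp add: A.add)
    then have "A e\<^sub>2 = 0" using \<open>A e\<^sub>2 \<in> H\<^sub>1\<close> \<open>A w \<in> H\<^sub>3\<close> skew(2) by auto
    then have zero1: "A x = 0" if "x \<in> H\<^sub>1" for x
      using A.eq_0_on_span[of B x] z that B e by auto
    have zero2: "A x = 0" if "x \<in> H\<^sub>2" for x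
    proof -
      obtain y y' where y: "y \<in> H\<^sub>1" "y' \<in> H\<^sub>3" "x = y + y'"
        using complement_decomposition[OF sub(1,3), of x] skew dim assms(1) by auto
      then have "A x = A y'" using zero1 by (simp add: A.add)
      then have "A x \<in> H\<^sub>2 \<inter> H\<^sub>3" using A that y by auto
      then show ?thesis using skew(3) by auto
    qed
    obtain y y' where "y \<in> H\<^sub>1" "y' \<in> H\<^sub>2" "v = y + y'"
      using complement_decomposition[OF sub(1,2), of v] skew dim assms(1) by auto
    then show "A v = 0" using zero1 zero2 by (simp add: A.add)
  qed
qed

text \<open>
  The identity and the maps \<open>A j\<close> with \<open>j \<notin> {a, b, c}\<close> fix the three skew planes, so evaluation at
  the separating vector turns a relation between their values into a relation between the maps
  themselves. With at least seven planes these are at least five maps, and their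
  values in the four-dimensional space are related. Applied to a vector of
  \<open>H j\<close>, it shows that \<open>A j\<close> cannot take part in it, as all others fix \<open>H j\<close>; and the identity alone
  satisfies no relation.
\<close>

lemma not_pairwise_skew:
  fixes I :: "'i set"
  assumes "dimension = 4" and I: "finite I" "card I \<ge> 7"
    and sub: "\<And>i. i \<in> I \<Longrightarrow> subspace (H i)" and dim: "\<And>i. i \<in> I \<Longrightarrow> dim (H i) = 2"
    and lin: "\<And>i. i \<in> I \<Longrightarrow> linear_endo scale (A i)"
    and inv: "\<And>i j. i \<in> I \<Longrightarrow> j \<in> I \<Longrightarrow> i \<noteq> j \<Longrightarrow> A j ` H i \<subseteq> H i"
    and moved: "\<And>i v. i \<in> I \<Longrightarrow> v \<in> H i \<Longrightarrow> A i v \<in> H i \<Longrightarrow> v = 0"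
    and abc: "a \<in> I" "b \<in> I" "c \<in> I" "a \<noteq> b" "a \<noteq> c" "b \<noteq> c"
    and skew: "H a \<inter> H b = {0}" "H a \<inter> H c = {0}" "H b \<inter> H c = {0}"
  shows False
proof -
  obtain u where u: "\<And>L v. \<lbrakk>linear_endo scale L; L ` H a \<subseteq> H a; L ` H b \<subseteq> H b; L ` H c \<subseteq> H c; L u = 0\<rbrakk>
      \<Longrightarrow> L v = 0"
    using separating_vector[of "H a" "H b" "H c"] assms(1) sub dim abc skew by metis
  \<comment> \<open>The index \<open>a\<close>, whose own map does not fix \<open>H a\<close>, is reused for the identity.\<close>
  define J where "J = I - {b, c}"
  define L where "L j = (if j = a then id else A j)" for j
  have J: "finite J" "card J > dimension"
    using I abc assms(1) by (auto simp: J_def card_Diff_subset)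
  have linL: "linear_endo scale (L j)" if "j \<in> J" for j
    using that lin linear_id by (auto simp: L_def J_def)
  obtain x where x: "\<exists>j\<in>J. x j \<noteq> 0" and xu: "(\<Sum>j\<in>J. scale (x j) (L j u)) = 0"
    using nontrivial_relation[OF J] by metis
  define M where "M v = (\<Sum>j\<in>J. scale (x j) (L j v))" for v
  have "linear_endo scale M"
  proof -
    have "L j (v + w) = L j v + L j w" "L j (scale r v) = scale r (L j v)" if "j \<in> J" for j v w r
      using linL[OF that] by (simp_all add: Vector_Spaces.linear_iff)
    then show ?thesis
      by (simp add: Vector_Spaces.linear_iff vector_space_axioms M_def scale_right_distrib
          sum.distrib scale_sum_right mult.commute)
  qed
  moreover have "M ` H i \<subseteq> H i" if "i \<in> {a, b, c}" for i
  proof -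
    have iI: "i \<in> I" using that abc by auto
    have "L j v \<in> H i" if "j \<in> J" "v \<in> H i" for j v
      using that inv[OF iI, of j] \<open>i \<in> {a, b, c}\<close> by (auto simp: L_def J_def)
    then show ?thesis
      unfolding M_def using sub[OF iI] by (auto intro!: subspace_sum subspace_scale)
  qed
  ultimately have M0: "M v = 0" for v using u[of M] xu by (simp add: M_def)
  have xA: "x j = 0" if j: "j \<in> J" "j \<noteq> a" for j
  proof (rule ccontr)
    assume "x j \<noteq> 0"
    have jI: "j \<in> I" using j by (simp add: J_def)
    obtain v where v: "v \<in> H j" "v \<noteq> 0"
      using dim[OF jI] dim_eq_0[of "H j"] by force
    have "scale (x j) (L j v) + (\<Sum>l\<in>J - {j}. scale (x l) (L l v)) = 0"
      using M0[of v] J(1) j(1) by (simp add: M_def sum.remove)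
    then have "scale (x j) (L j v) = - (\<Sum>l\<in>J - {j}. scale (x l) (L l v))"
      by (rule eq_neg_iff_add_eq_0[THEN iffD2])
    moreover have "L l v \<in> H j" if "l \<in> J - {j}" for l
      using that v inv[OF jI, of l] by (auto simp: L_def J_def)
    ultimately have "scale (x j) (L j v) \<in> H j"
      using sub[OF jI] by (auto intro!: subspace_neg subspace_sum subspace_scale)
    then have "scale (inverse (x j)) (scale (x j) (L j v)) \<in> H j"
      using sub[OF jI] subspace_scale by blast
    then have "A j v \<in> H j" using \<open>x j \<noteq> 0\<close> j by (simp add: L_def)
    then show False using moved[OF jI] v by blast
  qed
  have "a \<in> J" using abc by (simp add: J_def)
  then have "M v = scale (x a) v" for v
    unfolding M_def using xA J(1)
    by (simp add: sum.remove[of J a] L_def)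
  moreover obtain v where "v \<in> H a" "v \<noteq> 0"
    using dim[OF abc(1)] dim_eq_0[of "H a"] by force
  ultimately have "x a = 0" using M0[of v] by auto
  then show False using x xA by blast
qed

text \<open>
  The case distinction at the end is the proof of \<open>R(3,3) \<le> 6\<close>: one plane \<open>a\<close> meets three others
  or is skew to three others, and these three then contain the forbidden configuration, with or
  without \<open>a\<close>.
\<close>

theorem MSR_family_card_le_6:
  fixes I :: "'i set"
  assumes "dimension = 4" and "finite I"
    and sub: "\<And>i. i \<in> I \<Longrightarrow> subspace (H i)" and dim: "\<And>i. i \<in> I \<Longrightarrow> dim (H i) = 2"
    and lin: "\<And>i. i \<in> I \<Longrightarrow> linear_endo scale (A i)"
    and inv: "\<And>i j. i \<in> I \<Longrightarrow> j \<in> I \<Longrightarrow> i \<noteq> j \<Longrightarrow> A j ` H i \<subseteq> H i"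
    and moved: "\<And>i v. i \<in> I \<Longrightarrow> v \<in> H i \<Longrightarrow> A i v \<in> H i \<Longrightarrow> v = 0"
  shows "card I \<le> 6"
proof (rule ccontr)
  assume "\<not> card I \<le> 6"
  then have card7: "card I \<ge> 7" by simp
  define meets where "meets i j \<longleftrightarrow> H i \<inter> H j \<noteq> {0}" for i j
  have neq: "H i \<noteq> H j" if ij: "i \<in> I" "j \<in> I" "i \<noteq> j" for i j
  proof
    assume "H i = H j"
    then have "v = 0" if "v \<in> H i" for v using that moved inv ij by blast
    then show False using dim[OF ij(1)] dim_eq_0[of "H i"] by auto
  qed
  have no_triangle: False
    if "i \<in> I" "j \<in> I" "l \<in> I" "i \<noteq> j" "i \<noteq> l" "j \<noteq> l" "meets i j" "meets i l" "meets j l" for i j l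
    using not_pairwise_meeting[of "H i" "H j" "H l" "A l"] that neq sub dim lin inv moved
    by (metis meets_def)
  have no_skew: False
    if "i \<in> I" "j \<in> I" "l \<in> I" "i \<noteq> j" "i \<noteq> l" "j \<noteq> l" "\<not> meets i j" "\<not> meets i l" "\<not> meets j l" for i j l
    using not_pairwise_skew[OF \<open>dimension = 4\<close> \<open>finite I\<close> card7, of H A i j l] sub dim lin inv moved that
    by (auto simp: meets_def)
  obtain a where a: "a \<in> I" using card7 by fastforce
  have three: "\<exists>i j l. i \<in> S \<and> j \<in> S \<and> l \<in> S \<and> i \<noteq> j \<and> i \<noteq> l \<and> j \<noteq> l" if "card S \<ge> 3" for S :: "'i set"
  proof -
    obtain T where "T \<subseteq> S" "card T = 3" using obtain_subset_with_card_n[OF \<open>card S \<ge> 3\<close>] by blast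
    then show ?thesis by (auto simp: card_3_iff)
  qed
  define N where "N = {i \<in> I - {a}. meets a i}"
  define M where "M = {i \<in> I - {a}. \<not> meets a i}"
  have "card N + card M = card (N \<union> M)"
    using \<open>finite I\<close> by (intro card_Un_disjoint[symmetric]) (auto simp: N_def M_def)
  also have "N \<union> M = I - {a}" unfolding N_def M_def by blast
  finally have "card N + card M \<ge> 6" using card7 a by simp
  then consider "card N \<ge> 3" | "card M \<ge> 3" by linarith
  then show False
  proof cases
    case 1
    then obtain i j l where "i \<in> N" "j \<in> N" "l \<in> N" "i \<noteq> j" "i \<noteq> l" "j \<noteq> l"
      using three by blast
    then have ijl: "{i, j, l} \<subseteq> I - {a}" "meets a i" "meets a j" "meets a l" by (auto simp: N_def)
    have "\<not> meets i j" "\<not> meets i l" "\<not> meets j l"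
      using no_triangle[of a i j] no_triangle[of a i l] no_triangle[of a j l] a ijl
        \<open>i \<noteq> j\<close> \<open>i \<noteq> l\<close> \<open>j \<noteq> l\<close> by blast+
    then show False using no_skew[of i j l] ijl \<open>i \<noteq> j\<close> \<open>i \<noteq> l\<close> \<open>j \<noteq> l\<close> by blast
  next
    case 2
    then obtain i j l where "i \<in> M" "j \<in> M" "l \<in> M" "i \<noteq> j" "i \<noteq> l" "j \<noteq> l"
      using three by blast
    then have ijl: "{i, j, l} \<subseteq> I - {a}" "\<not> meets a i" "\<not> meets a j" "\<not> meets a l"
      by (auto simp: M_def)
    have "meets i j" "meets i l" "meets j l"
      using no_skew[of a i j] no_skew[of a i l] no_skew[of a j l] a ijl
        \<open>i \<noteq> j\<close> \<open>i \<noteq> l\<close> \<open>j \<noteq> l\<close> by blast+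
    then show False using no_triangle[of i j l] ijl \<open>i \<noteq> j\<close> \<open>i \<noteq> l\<close> \<open>j \<noteq> l\<close> by blast
  qed
qed

section \<open>Interference alignment\<close>

text \<open>
  A pair \<open>(a, b)\<close> stands for the codeword with entries \<open>a + b\<close> and \<open>\<phi>\<^sub>i a + \<phi>\<^sub>m b\<close> in the two parity
  positions, in which \<open>a\<close> carries the contents of entry \<open>i\<close>, \<open>b\<close> those of the entry \<open>m\<close> to be repaired,
  and the other entries are zero. The subspaces \<open>K\<close>, \<open>P\<close>, \<open>R\<close> describe the downloads that vanish, and
  \<open>repair\<close> says that entry \<open>m\<close> is determined by the downloads.

  Taking \<open>a = 0\<close> shows that \<open>R\<close> and \<open>\<phi>\<^sub>m P\<close> meet trivially, so by their dimensions they are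
  complementary. This makes it possible to complete every \<open>a \<in> K\<close> to a pair with vanishing parity
  downloads; then \<open>b = 0\<close>, which says that \<open>a \<in> P\<close> and \<open>\<phi>\<^sub>i a \<in> R\<close>. Comparing dimensions turns
  these inclusions into equalities.
\<close>

lemma repair_subspaces:
  assumes \<phi>: "linear_endo scale \<phi>\<^sub>i" "inj \<phi>\<^sub>i" "linear_endo scale \<phi>\<^sub>m"
    and sub: "subspace P" "subspace R" "subspace K"
    and dim: "dim P \<ge> d" "dim R \<ge> d" "dim K \<ge> d" "dimension = 2 * d"
    and repair: "\<forall>a\<in>K. \<forall>b. a + b \<in> P \<longrightarrow> \<phi>\<^sub>i a + \<phi>\<^sub>m b \<in> R \<longrightarrow> b = 0"
  shows "dim P = d" and "\<phi>\<^sub>i ` P = R" and "\<forall>v\<in>P. \<phi>\<^sub>m v \<in> R \<longrightarrow> v = 0"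
proof -
  interpret i: Vector_Spaces.linear scale scale \<phi>\<^sub>i by fact
  interpret m: Vector_Spaces.linear scale scale \<phi>\<^sub>m by fact
  interpret pair: finite_dimensional_vector_space_pair scale Basis scale Basis ..
  have moved: "v = 0" if "v \<in> P" "\<phi>\<^sub>m v \<in> R" for v
    using repair[rule_format, of 0 v] that subspace_0[OF sub(3)] by simp
  then show "\<forall>v\<in>P. \<phi>\<^sub>m v \<in> R \<longrightarrow> v = 0" by blast
  have subQ: "subspace (\<phi>\<^sub>m ` P)" using m.subspace_image sub(1) by blast
  have "inj_on \<phi>\<^sub>m P"
    using moved sub subspace_0 by (simp add: m.inj_on_iff_eq_0)
  then have dimQ: "dim (\<phi>\<^sub>m ` P) = dim P"
    using pair.dim_image_eq[OF \<phi>(3), of P] span_eq_iff[THEN iffD2, OF sub(1)] by simp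
  have RQ: "R \<inter> \<phi>\<^sub>m ` P = {0}" using moved subspace_0[OF sub(2)] subspace_0[OF subQ] m.zero by blast
  have "dim R + dim P \<le> 2 * d"
    using dim_sums_Int[OF sub(2) subQ] RQ dimQ dim(4)
      dim_subset_UNIV[of "{x + y |x y. x \<in> R \<and> y \<in> \<phi>\<^sub>m ` P}"] by simp
  then have dims: "dim R = d" "dim P = d" using dim by linarith+
  then show "dim P = d" by simp
  have K: "a \<in> P \<and> \<phi>\<^sub>i a \<in> R" if "a \<in> K" for a
  proof -
    obtain r y where "r \<in> R" "y \<in> \<phi>\<^sub>m ` P" and eq: "\<phi>\<^sub>i a - \<phi>\<^sub>m a = r + y"
      using complement_decomposition[OF sub(2) subQ RQ, of "\<phi>\<^sub>i a - \<phi>\<^sub>m a"] dims dimQ dim(4) by auto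
    then obtain p where p: "p \<in> P" "y = \<phi>\<^sub>m p" by auto
    (* Solving a + b = - p and \<phi>\<^sub>i a + \<phi>\<^sub>m b = r for b = - p - a. *)
    have \<phi>a: "\<phi>\<^sub>i a = r + \<phi>\<^sub>m p + \<phi>\<^sub>m a" using eq p(2) by (simp only: diff_eq_eq)
    have "- p - a = 0"
    proof (rule repair[rule_format, of a])
      show "a + (- p - a) \<in> P" using p sub(1) by (simp add: subspace_neg)
      have "\<phi>\<^sub>i a + \<phi>\<^sub>m (- p - a) = r" unfolding \<phi>a m.diff m.neg by simp
      then show "\<phi>\<^sub>i a + \<phi>\<^sub>m (- p - a) \<in> R" using \<open>r \<in> R\<close> by simp
    qed (rule that)
    then have a: "a = - p" by (simp only: right_minus_eq)
    have "a \<in> P" unfolding a using p(1) sub(1) by (rule subspace_neg[rotated])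
    moreover have "\<phi>\<^sub>i a = r"
    proof -
      have "\<phi>\<^sub>m a = - \<phi>\<^sub>m p" unfolding a by (rule m.neg)
      then show ?thesis using \<phi>a by simp
    qed
    ultimately show ?thesis using \<open>r \<in> R\<close> by simp
  qed
  then have "K = P" using subspace_dim_equal[OF sub(3,1)] dims dim(3) by auto
  then have "\<phi>\<^sub>i ` P \<subseteq> R" using K by auto
  moreover have "dim (\<phi>\<^sub>i ` P) = d"
    using pair.dim_image_eq[OF \<phi>(1) inj_on_subset[OF \<phi>(2) subset_UNIV]] dims by simp
  ultimately show "\<phi>\<^sub>i ` P = R"
    using subspace_dim_equal[OF i.subspace_image[OF sub(1)] sub(2)] dims by simp
qed

end

section \<open>Kernels of downloads\<close>

context finite_dimensional_vector_space_pair
begin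

lemma dim_kernel_ge:
  assumes "Vector_Spaces.linear s1 s2 f"
  shows "vs1.dim {x. f x = 0} + vs2.dimension \<ge> vs1.dimension"
proof -
  interpret f: Vector_Spaces.linear s1 s2 f by fact
  obtain g where g: "Vector_Spaces.linear s2 s1 g" "\<And>x. f (g (f x)) = f x"
    using linear_exists_right_inverse_on[OF assms vs1.subspace_UNIV] by auto
  interpret g: Vector_Spaces.linear s2 s1 g by fact
  let ?K = "{x. f x = 0}"
  have sub: "vs1.subspace ?K" "vs1.subspace (range g)"
    using f.subspace_kernel g.subspace_image[OF vs2.subspace_UNIV] by auto
  have "x = (x - g (f x)) + g (f x)" "x - g (f x) \<in> ?K" for x
    using g(2) by (simp_all add: f.diff)
  then have UNIV: "{x + y |x y. x \<in> ?K \<and> y \<in> range g} = UNIV" by blast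
  have "vs1.dimension \<le> vs1.dim ?K + vs1.dim (range g)"
    using vs1.dim_sums_Int[OF sub] unfolding UNIV vs1.dim_UNIV vs1.dimension_def by linarith
  moreover have "vs1.dim (range g) \<le> vs2.dimension"
  proof -
    interpret swap: finite_dimensional_vector_space_pair s2 B2 s1 B1 ..
    show ?thesis using swap.dim_image_le[OF g(1), of UNIV]
      by (simp add: vs2.dimension_def)
  qed
  ultimately show ?thesis by simp
qed

end

lemma vec_dimension: "vec.dimension TYPE('a::field) TYPE('n::finite) = CARD('n)"
  by (simp add: vec.dimension_def card_cart_basis)

text \<open>
  The dimension theory needs a finite-dimensional type, whereas the entries of a codeword are functions
  on \<^typ>\<open>nat\<close>. Any bijection between \<open>{1..CARD('n)}\<close> and the index type \<open>'n\<close> serves to identify the two.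
\<close>

definition index_of :: "nat \<Rightarrow> 'n::finite" where
  "index_of = (SOME f. bij_betw f {1..CARD('n)} UNIV)"

definition to_coord :: "'a::field ^ 'n \<Rightarrow> nat \<Rightarrow> 'a" where
  "to_coord v = (\<lambda>j. if j \<in> {1..CARD('n)} then v $ index_of j else 0)"

definition of_coord :: "(nat \<Rightarrow> 'a::field) \<Rightarrow> 'a ^ 'n" where
  "of_coord x = (\<chi> i. x (inv_into {1..CARD('n)} index_of i))"

lemma bij_index_of: "bij_betw (index_of :: nat \<Rightarrow> 'n::finite) {1..CARD('n)} UNIV"
proof -
  have "\<exists>f. bij_betw f {1..CARD('n)} (UNIV :: 'n set)"
    using finite_same_card_bij[of "{1..CARD('n)}" "UNIV :: 'n set"] by simp
  then show ?thesis unfolding index_of_def by (rule someI_ex)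
qed

lemma of_coord_to_coord [simp]: "of_coord (to_coord v) = (v :: 'a::field ^ 'n)"
proof -
  have "inv_into {1..CARD('n)} index_of i \<in> {1..CARD('n)}" for i :: 'n
    using bij_index_of[where 'n = 'n] by (metis bij_betw_def inv_into_into iso_tuple_UNIV_I)
  then show ?thesis
    using bij_betw_inv_into_right[OF bij_index_of[where 'n = 'n]]
    by (simp add: of_coord_def to_coord_def vec_eq_iff)
qed

lemma to_coord_of_coord:
  "x \<in> coord_space (CARD('n)) \<Longrightarrow> to_coord (of_coord x :: 'a::field ^ 'n) = x"
  using bij_betw_inv_into_left[OF bij_index_of[where 'n = 'n]]
  by (auto simp: of_coord_def to_coord_def coord_space_def fun_eq_iff)

lemma to_coord_in_coord_space: "to_coord (v :: 'a::field ^ 'n) \<in> coord_space (CARD('n))"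
  by (simp add: to_coord_def coord_space_def)

lemma to_coord_add: "to_coord (v + w) = to_coord v + to_coord w"
  by (auto simp: to_coord_def)

lemma to_coord_scale: "to_coord (a *s v) = vec_scale a (to_coord v)"
  by (auto simp: to_coord_def vec_scale_def)

lemma of_coord_add: "of_coord (x + y) = of_coord x + of_coord y"
  by (simp add: of_coord_def vec_eq_iff)

lemma of_coord_scale: "of_coord (vec_scale a x) = a *s of_coord x"
  by (simp add: of_coord_def vec_scale_def vec_eq_iff)

lemma to_coord_0 [simp]: "to_coord 0 = 0"
  by (auto simp: to_coord_def)

lemma of_coord_0 [simp]: "of_coord 0 = 0"
  by (simp add: of_coord_def vec_eq_iff)

lemma vec_scale_0 [simp]: "vec_scale a 0 = 0"
  by (auto simp: vec_scale_def)

lemma linear_map_on_0: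
  assumes "linear_map_on s t V W f" and "0 \<in> V"
  shows "f 0 = 0"
proof -
  have "f (0 + 0) = f 0 + f 0" using assms unfolding linear_map_on_def by blast
  then show ?thesis by simp
qed

text \<open>
  The linear map \<open>L\<close> allows the vanishing of a download to be expressed in the parameter \<open>a\<close> of a
  codeword instead of the entry \<open>L a\<close> itself.
\<close>

lemma download_kernel:
  fixes L :: "'a::field ^ 'n \<Rightarrow> 'a ^ 'n"
  assumes h: "linear_map_on vec_scale vec_scale (coord_space (CARD('n))) (coord_space (CARD('m))) h"
    and L: "linear_endo (*s) L"
  shows "vec.subspace {a. h (to_coord (L a)) = 0}"
    and "vec.dim {a. h (to_coord (L a)) = 0} + CARD('m::finite) \<ge> CARD('n)"
proof -
  define f :: "'a ^ 'n \<Rightarrow> 'a ^ 'm" where "f a = of_coord (h (to_coord (L a)))" for a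
  have hC: "h (to_coord v) \<in> coord_space (CARD('m))"
    and h_add: "h (to_coord v + to_coord w) = h (to_coord v) + h (to_coord w)"
    and h_scale: "h (vec_scale r (to_coord v)) = vec_scale r (h (to_coord v))"
    for v w :: "'a ^ 'n" and r
    using h to_coord_in_coord_space unfolding linear_map_on_def by blast+
  have "L (v + w) = L v + L w" "L (r *s v) = r *s L v" for v w r
    using L by (simp_all add: Vector_Spaces.linear_iff)
  then have f: "Vector_Spaces.linear (*s) (*s) f"
    by (simp add: Vector_Spaces.linear_iff f_def to_coord_add to_coord_scale h_add h_scale
        of_coord_add of_coord_scale vec.vector_space_axioms)
  have "h (to_coord (L a)) = 0 \<longleftrightarrow> f a = 0" for a
    unfolding f_def using to_coord_of_coord[OF hC, of "L a"] by (metis of_coord_0 to_coord_0)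
  then have eq: "{a. h (to_coord (L a)) = 0} = {a. f a = 0}" by simp
  show "vec.subspace {a. h (to_coord (L a)) = 0}"
  proof -
    interpret f: Vector_Spaces.linear "(*s)" "(*s)" f by fact
    show ?thesis unfolding eq by (rule f.subspace_kernel)
  qed
  show "vec.dim {a. h (to_coord (L a)) = 0} + CARD('m) \<ge> CARD('n)"
    unfolding eq using vec.dim_kernel_ge[OF f] by (simp add: vec_dimension)
qed

section \<open>MDS codes and MSR codes\<close>

lemma coord_space_tuple: "c \<in> tuple_space I l \<Longrightarrow> c i \<in> coord_space l"
  by (cases "i \<in> I") (auto simp: tuple_space_def coord_space_def)

definition unit_tuple :: "nat \<times> nat \<Rightarrow> nat \<Rightarrow> nat \<Rightarrow> 'a::field" where
  "unit_tuple p = (\<lambda>i j. if (i, j) = p then 1 else 0)"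

lemma tuple_space_subset_span:
  assumes "finite S"
  shows "tuple_space S l \<subseteq> tuple.span (unit_tuple ` (S \<times> {1..l}))"
proof
  fix c :: "nat \<Rightarrow> nat \<Rightarrow> 'a"
  assume c: "c \<in> tuple_space S l"
  have sum_apply: "(\<Sum>p\<in>A. g p) i j = (\<Sum>p\<in>A. g p i j)"
    for A :: "(nat \<times> nat) set" and g :: "_ \<Rightarrow> nat \<Rightarrow> nat \<Rightarrow> 'a" and i j
    by (induction A rule: infinite_finite_induct) auto
  have "c = (\<Sum>p\<in>S \<times> {1..l}. tuple_scale (c (fst p) (snd p)) (unit_tuple p))"
  proof (intro ext)
    fix i j
    have "(\<Sum>p\<in>S \<times> {1..l}. tuple_scale (c (fst p) (snd p)) (unit_tuple p)) i j
        = (\<Sum>p\<in>S \<times> {1..l}. if p = (i, j) then c i j else 0)"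
      unfolding sum_apply
      by (intro sum.cong) (auto simp: tuple_scale_def vec_scale_def unit_tuple_def)
    also have "\<dots> = c i j"
      using c assms by (auto simp: tuple_space_def coord_space_def)
    finally show "c i j = (\<Sum>p\<in>S \<times> {1..l}. tuple_scale (c (fst p) (snd p)) (unit_tuple p)) i j" ..
  qed
  also have "\<dots> \<in> tuple.span (unit_tuple ` (S \<times> {1..l}))"
    by (intro tuple.span_sum tuple.span_scale tuple.span_base) auto
  finally show "c \<in> tuple.span (unit_tuple ` (S \<times> {1..l}))" .
qed

lemma MDS_code_eqI:
  assumes "is_MDS_code n k l C" "S \<subseteq> {1..n}" "card S = k" "c \<in> C" "d \<in> C"
    and "\<And>i. i \<in> S \<Longrightarrow> c i = d i"
  shows "c = d"
  using assms unfolding is_MDS_code_def by blast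

text \<open>
  Restriction to \<open>S\<close> is injective on the code by the MDS property, and the code has the same
  dimension \<open>k * l\<close> as the space of all tuples over \<open>S\<close>. So the restriction is also surjective.
\<close>

lemma MDS_code_information_set:
  fixes C :: "(nat \<Rightarrow> nat \<Rightarrow> 'a::field) set"
  assumes mds: "is_MDS_code n k l C" and S: "S \<subseteq> {1..n}" "card S = k" and v: "v \<in> tuple_space S l"
  shows "\<exists>c\<in>C. \<forall>i\<in>S. c i = v i"
proof -
  have "finite S" using S(1) finite_subset by blast
  have C: "C \<subseteq> tuple_space {1..n} l" "tuple.subspace C" "tuple.dim C = k * l"
    using mds by (auto simp: is_MDS_code_def)
  define \<pi> where "\<pi> c = (\<lambda>i. if i \<in> S then c i else 0)" for c :: "nat \<Rightarrow> nat \<Rightarrow> 'a"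
  have \<pi>: "Vector_Spaces.linear tuple_scale tuple_scale \<pi>"
    unfolding Vector_Spaces.linear_iff
    by (auto simp: tuple.vector_space_axioms \<pi>_def tuple_scale_def vec_scale_def fun_eq_iff)
  interpret \<pi>: Vector_Spaces.linear tuple_scale tuple_scale \<pi> by fact
  obtain B where B: "B \<subseteq> C" "tuple.independent B" "C \<subseteq> tuple.span B" "card B = k * l"
    using tuple.basis_exists[of C] C(3) by metis
  have spanB: "tuple.span B = C" using B C(2) by (simp add: tuple.span_subspace)
  have "c = d" if "c \<in> C" "d \<in> C" "\<pi> c = \<pi> d" for c d
  proof (rule MDS_code_eqI[OF mds S that(1,2)])
    show "c i = d i" if "i \<in> S" for i
      using fun_cong[OF \<open>\<pi> c = \<pi> d\<close>, of i] that by (simp add: \<pi>_def)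
  qed
  then have inj: "inj_on \<pi> C" by (auto intro: inj_onI)
  have indep: "tuple.independent (\<pi> ` B)"
    using \<pi>.independent_injective_image B(2) inj spanB by simp
  have "card (\<pi> ` B) = k * l" using card_image[OF inj_on_subset[OF inj B(1)]] B(4) by simp
  have "\<pi> c \<in> tuple_space S l" if "c \<in> C" for c
    using coord_space_tuple[OF subsetD[OF C(1) that]] by (simp add: \<pi>_def tuple_space_def)
  then have \<pi>B: "\<pi> ` B \<subseteq> tuple_space S l" using B(1) by blast
  have "v \<in> tuple.span (\<pi> ` B)"
  proof (rule ccontr)
    assume out: "v \<notin> tuple.span (\<pi> ` B)"
    \<comment> \<open>Then \<open>\<pi> ` B\<close> and \<open>v\<close> are \<open>k * l + 1\<close> independent tuples in a space spanned by \<open>k * l\<close>.\<close>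
    let ?E = "unit_tuple ` (S \<times> {1..l}) :: (nat \<Rightarrow> nat \<Rightarrow> 'a) set"
    have "insert v (\<pi> ` B) \<subseteq> tuple.span ?E"
      using tuple_space_subset_span[OF \<open>finite S\<close>] v \<pi>B by blast
    then have bound: "finite (insert v (\<pi> ` B)) \<and> card (insert v (\<pi> ` B)) \<le> card ?E"
      using \<open>finite S\<close> tuple.independent_insertI[OF out indep]
      by (intro tuple.independent_span_bound finite_imageI) simp_all
    moreover have "v \<notin> \<pi> ` B" using out tuple.span_base by blast
    moreover have "card ?E \<le> k * l"
      using card_image_le[of "S \<times> {1..l}" "unit_tuple :: _ \<Rightarrow> nat \<Rightarrow> nat \<Rightarrow> 'a"] \<open>finite S\<close> S(2)
      by (simp add: card_cartesian_product)
    ultimately show False using bound \<open>card (\<pi> ` B) = k * l\<close> by simp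
  qed
  then have "v \<in> \<pi> ` C" using \<pi>.span_image[of B] spanB by simp
  then obtain c where "c \<in> C" "v = \<pi> c" by blast
  then show ?thesis by (auto simp: \<pi>_def)
qed

text \<open>
  The codewords that vanish on \<open>{1..k} - {i}\<close>, parametrised by their entry at \<open>k + 1\<close>: the map \<open>E j\<close>
  sends the parameter to entry \<open>j\<close>. The parametrisation exists since \<open>{1..k} - {i}\<close> together with \<open>k + 1\<close> is an
  information set, and it is linear because these codewords are unique.
\<close>

lemma MDS_shortened_code:
  fixes C :: "(nat \<Rightarrow> nat \<Rightarrow> 'a::field) set"
  assumes mds: "is_MDS_code (k + 2) k (CARD('n::finite)) C" and i: "i \<in> {1..k}"
  shows "\<exists>E :: nat \<Rightarrow> 'a ^ 'n \<Rightarrow> 'a ^ 'n. (\<forall>j. linear_endo (*s) (E j)) \<and>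
      (\<forall>a. (\<lambda>j. to_coord (E j a)) \<in> C) \<and> (\<forall>a. E (k + 1) a = a) \<and>
      (\<forall>j\<in>{1..k} - {i}. \<forall>a. E j a = 0) \<and>
      (\<forall>T a. T \<subseteq> {1..k + 2} \<longrightarrow> card T = k \<longrightarrow> (\<forall>j\<in>T. E j a = 0) \<longrightarrow> a = 0)"
proof -
  have C: "C \<subseteq> tuple_space {1..k + 2} (CARD('n))" "tuple.subspace C"
    using mds by (simp_all add: is_MDS_code_def)
  define S where "S = insert (k + 1) ({1..k} - {i})"
  have S: "S \<subseteq> {1..k + 2}" "card S = k"
    using i by (auto simp: S_def card_insert_if)
  have "\<exists>c\<in>C. c (k + 1) = to_coord a \<and> (\<forall>j\<in>{1..k} - {i}. c j = 0)" for a :: "'a ^ 'n"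
  proof -
    have "(\<lambda>j. if j = k + 1 then to_coord a else 0) \<in> tuple_space S (CARD('n))"
      using to_coord_in_coord_space[of a] by (simp add: tuple_space_def coord_space_def S_def)
    then have "\<exists>c\<in>C. \<forall>j\<in>S. c j = (if j = k + 1 then to_coord a else 0)"
      by (rule MDS_code_information_set[OF mds S])
    then show ?thesis by (simp add: S_def)
  qed
  then obtain w where wC: "w a \<in> C" and w1: "w a (k + 1) = to_coord a"
    and w0: "j \<in> {1..k} - {i} \<Longrightarrow> w a j = 0" for a :: "'a ^ 'n" and j
    by metis
  have w_eqI: "c = w a"
    if "c \<in> C" "c (k + 1) = to_coord a" "\<And>j. j \<in> {1..k} - {i} \<Longrightarrow> c j = 0" for c a
  proof (rule MDS_code_eqI[OF mds S that(1) wC])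
    show "c j = w a j" if "j \<in> S" for j
      using that \<open>c (k + 1) = to_coord a\<close> w1[of a] w0[of j a] \<open>j \<in> {1..k} - {i} \<Longrightarrow> c j = 0\<close>
      by (auto simp: S_def)
  qed
  have w_add: "w (a + b) = w a + w b" for a b
    using wC tuple.subspace_add[OF C(2)]
    by (intro w_eqI[symmetric]) (simp_all add: w0 w1[simplified] to_coord_add)
  have w_scale: "w (r *s a) = tuple_scale r (w a)" for r a
    using wC tuple.subspace_scale[OF C(2)]
    by (intro w_eqI[symmetric]) (simp_all add: w0 w1[simplified] to_coord_scale tuple_scale_def)
  define E :: "nat \<Rightarrow> 'a ^ 'n \<Rightarrow> 'a ^ 'n" where "E j a = of_coord (w a j)" for j a
  have E: "to_coord (E j a) = w a j" for j a
    unfolding E_def using coord_space_tuple[OF subsetD[OF C(1) wC]] by (rule to_coord_of_coord)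
  show ?thesis
  proof (intro exI[of _ E] conjI allI ballI impI)
    show "linear_endo (*s) (E j)" for j
      by (simp add: Vector_Spaces.linear_iff vec.vector_space_axioms E_def w_add
          w_scale of_coord_add of_coord_scale tuple_scale_def)
    show "(\<lambda>j. to_coord (E j a)) \<in> C" for a
      using wC[of a] by (simp add: E)
    show "E (k + 1) a = a" for a
      unfolding E_def w1 by simp
    show "E j a = 0" if "j \<in> {1..k} - {i}" for j a
      unfolding E_def w0[OF that] by simp
    show "a = 0" if T: "T \<subseteq> {1..k + 2}" "card T = k" "\<forall>j\<in>T. E j a = 0" for T a
    proof -
      have "w a = 0"
      proof (rule MDS_code_eqI[OF mds T(1,2) wC tuple.subspace_0[OF C(2)]])
        show "w a j = 0 j" if "j \<in> T" for j
          using E[of j a] bspec[OF T(3) that] by simp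
      qed
      then have "to_coord a = 0" using w1[of a] by simp
      then show "a = 0" by (metis of_coord_0 of_coord_to_coord)
    qed
  qed
qed

text \<open>
  The map \<open>\<phi> i\<close> takes entry \<open>k + 1\<close> to entry \<open>k + 2\<close> in the codewords that vanish on
  \<open>{1..k} - {i}\<close>, and \<open>P m\<close> and \<open>R m\<close> are the kernels of the downloads from these two entries in
  the repair of \<open>m\<close>. The properties claimed are those of \<open>repair_subspaces\<close>, applied to sums of a
  codeword that vanishes on \<open>{1..k} - {i}\<close> and one that vanishes on \<open>{1..k} - {m}\<close>.
\<close>

lemma MSR_code_repair_family:
  fixes C :: "(nat \<Rightarrow> nat \<Rightarrow> 'a::field) set"
  assumes msr: "is_MSR_code (k + 2) k 4 C"
  shows "\<exists>(\<phi> :: nat \<Rightarrow> 'a ^ 4 \<Rightarrow> 'a ^ 4) P R.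
      (\<forall>i\<in>{1..k}. linear_endo (*s) (\<phi> i) \<and> inj (\<phi> i)) \<and>
      (\<forall>m\<in>{1..k}. vec.subspace (P m) \<and> (\<forall>i\<in>{1..k} - {m}. vec.dim (P m) = 2 \<and>
        \<phi> i ` P m = R m \<and> (\<forall>v\<in>P m. \<phi> m v \<in> R m \<longrightarrow> v = 0)))"
proof -
  have mds: "is_MDS_code (k + 2) k 4 C" using msr by (simp add: is_MSR_code_def)
  have C: "tuple.subspace C" using mds by (simp add: is_MDS_code_def)
  have "\<forall>i\<in>{1..k}. \<exists>E :: nat \<Rightarrow> 'a ^ 4 \<Rightarrow> 'a ^ 4. (\<forall>j. linear_endo (*s) (E j)) \<and>
      (\<forall>a. (\<lambda>j. to_coord (E j a)) \<in> C) \<and> (\<forall>a. E (k + 1) a = a) \<and>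
      (\<forall>j\<in>{1..k} - {i}. \<forall>a. E j a = 0) \<and>
      (\<forall>T a. T \<subseteq> {1..k + 2} \<longrightarrow> card T = k \<longrightarrow> (\<forall>j\<in>T. E j a = 0) \<longrightarrow> a = 0)"
    (is "\<forall>i\<in>_. \<exists>E. ?word i E")
    using MDS_shortened_code[where 'n = 4 and k = k and C = C] mds by simp
  then obtain E where E: "\<forall>i\<in>{1..k}. ?word i (E i)" by (rule bchoice[THEN exE])
  have linE: "linear_endo (*s) (E i j)" and wordE: "(\<lambda>j. to_coord (E i j a)) \<in> C"
    and E1: "E i (k + 1) a = a" and E0: "j \<in> {1..k} - {i} \<Longrightarrow> E i j a = 0"
    and vanish: "T \<subseteq> {1..k + 2} \<Longrightarrow> card T = k \<Longrightarrow> \<forall>j\<in>T. E i j a = 0 \<Longrightarrow> a = 0"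
    if "i \<in> {1..k}" for i j a T
    using E[rule_format, OF that] by blast+
  have inj: "inj (E i (k + 2))" if i: "i \<in> {1..k}" for i
  proof -
    interpret E: Vector_Spaces.linear "(*s)" "(*s)" "E i (k + 2)" by (rule linE[OF i])
    have "a = 0" if "E i (k + 2) a = 0" for a
    proof (rule vanish[OF i])
      show "insert (k + 2) ({1..k} - {i}) \<subseteq> {1..k + 2}" by auto
      show "card (insert (k + 2) ({1..k} - {i})) = k" using i by (auto simp: card_insert_if)
      show "\<forall>j\<in>insert (k + 2) ({1..k} - {i}). E i j a = 0" using that E0[OF i] by simp
    qed
    then show ?thesis unfolding E.inj_iff_eq_0 by blast
  qed
  have repair: "\<exists>P R. vec.subspace P \<and> (\<forall>i\<in>{1..k} - {m}. vec.dim P = 2 \<and>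
      E i (k + 2) ` P = R \<and> (\<forall>v\<in>P. E m (k + 2) v \<in> R \<longrightarrow> v = 0))"
    if m: "m \<in> {1..k}" for m
  proof -
    have div: "4 div (2 :: nat) = 2" by simp
    note rep = msr[unfolded is_MSR_code_def add_diff_cancel_left' div, THEN conjunct2, THEN conjunct2]
    obtain h g
      where h: "\<forall>i\<in>{1..k + 2} - {m}.
          linear_map_on vec_scale vec_scale (coord_space 4) (coord_space 2) (h i)"
        and g: "linear_map_on tuple_scale vec_scale (tuple_space ({1..k + 2} - {m}) 2) (coord_space 4) g"
        and gh: "\<forall>c\<in>C. c m = g (\<lambda>i. if i \<in> {1..k + 2} - {m} then h i (c i) else 0)"
      using bspec[OF rep m] by (elim exE conjE) (rule that)
    have h0: "h i 0 = 0" if "i \<in> {1..k + 2} - {m}" for i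
      by (rule linear_map_on_0[OF bspec[OF h that]]) (simp add: coord_space_def)
    have "g 0 = 0"
      by (rule linear_map_on_0[OF g]) (simp add: tuple_space_def coord_space_def)
    have no_download: "c m = 0" if "c \<in> C" "\<And>i. i \<in> {1..k + 2} - {m} \<Longrightarrow> h i (c i) = 0" for c
    proof -
      have "(\<lambda>i. if i \<in> {1..k + 2} - {m} then h i (c i) else 0) = 0" using that(2) by auto
      then show ?thesis using bspec[OF gh that(1)] \<open>g 0 = 0\<close> by (simp only:)
    qed
    have kernel: "vec.subspace {a. h i (to_coord (L a)) = 0}"
        "vec.dim {a. h i (to_coord (L a)) = 0} \<ge> 2"
      if "i \<in> {1..k + 2} - {m}" "linear_endo (*s) L" for i and L :: "'a ^ 4 \<Rightarrow> 'a ^ 4"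
      using download_kernel[where 'n = 4 and 'm = 2, of "h i" L] bspec[OF h that(1)] that(2) by simp_all
    define P where "P = {a :: 'a ^ 4. h (k + 1) (to_coord a) = 0}"
    define R where "R = {a :: 'a ^ 4. h (k + 2) (to_coord a) = 0}"
    have PR: "vec.subspace P" "vec.dim P \<ge> 2" "vec.subspace R" "vec.dim R \<ge> 2"
      unfolding P_def R_def using kernel[OF _ vec.linear_ident] m by auto
    have "vec.dim P = 2 \<and> E i (k + 2) ` P = R \<and> (\<forall>v\<in>P. E m (k + 2) v \<in> R \<longrightarrow> v = 0)"
      if i: "i \<in> {1..k} - {m}" for i
    proof -
      have ik: "i \<in> {1..k}" using i by simp
      define K where "K = {a. h i (to_coord (E i i a)) = 0}"
      have K: "vec.subspace K" "vec.dim K \<ge> 2"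
        unfolding K_def using kernel[OF _ linE[OF ik]] i by auto
      have zero: "b = 0" if ab: "a \<in> K" "a + b \<in> P" "E i (k + 2) a + E m (k + 2) b \<in> R" for a b
      proof -
        define c where "c = (\<lambda>j. to_coord (E i j a)) + (\<lambda>j. to_coord (E m j b))"
        have c: "c j = to_coord (E i j a + E m j b)" for j by (simp add: c_def to_coord_add)
        have "c m = 0"
        proof (rule no_download)
          show "c \<in> C" unfolding c_def using wordE[OF ik] wordE[OF m] C by (rule tuple.subspace_add[rotated])
          fix j assume j: "j \<in> {1..k + 2} - {m}"
          consider "j = k + 1" | "j = k + 2" | "j = i" | "j \<in> {1..k} - {i}" "j \<in> {1..k} - {m}"
            using j by force
          then show "h j (c j) = 0"
          proof cases
            case 1
            then show ?thesis using ab(2) by (simp add: c E1[OF ik, simplified] E1[OF m, simplified] P_def)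
          next
            case 2
            then show ?thesis using ab(3) by (simp add: c R_def)
          next
            case 3
            then show ?thesis using ab(1) E0[OF m, of i b] i by (simp add: c K_def)
          next
            case 4
            then show ?thesis using h0[OF j] by (simp add: c E0[OF ik] E0[OF m])
          qed
        qed
        moreover have "E i m a = 0" using E0[OF ik, of m a] i m by simp
        ultimately have "E m m b = 0" using of_coord_to_coord[of "E m m b"] by (simp add: c)
        then have "\<forall>j\<in>{1..k}. E m j b = 0" using E0[OF m] by blast
        then show "b = 0" using vanish[OF m, of "{1..k}" b] by simp
      qed
      have dim4: "vec.dimension TYPE('a) TYPE(4) = 2 * 2" by (simp add: vec_dimension)
      have "\<forall>a\<in>K. \<forall>b. a + b \<in> P \<longrightarrow> E i (k + 2) a + E m (k + 2) b \<in> R \<longrightarrow> b = 0"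
        using zero by blast
      from vec.repair_subspaces[OF linE[OF ik] inj[OF ik] linE[OF m] PR(1,3) K(1) PR(2,4) K(2) dim4 this]
      show ?thesis by (intro conjI)
    qed
    then have "\<forall>i\<in>{1..k} - {m}. vec.dim P = 2 \<and> E i (k + 2) ` P = R \<and>
        (\<forall>v\<in>P. E m (k + 2) v \<in> R \<longrightarrow> v = 0)"
      by (rule ballI)
    with PR(1) show ?thesis by (intro exI[of _ P] exI[of _ R] conjI)
  qed
  (* The two subspaces are chosen as a pair, since R m is tied to P m. *)
  then have "\<forall>m\<in>{1..k}. \<exists>PR. vec.subspace (fst PR) \<and> (\<forall>i\<in>{1..k} - {m}. vec.dim (fst PR) = 2 \<and>
      E i (k + 2) ` fst PR = snd PR \<and> (\<forall>v\<in>fst PR. E m (k + 2) v \<in> snd PR \<longrightarrow> v = 0))"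
    unfolding split_paired_Ex fst_conv snd_conv by (rule ballI)
  then obtain PR where PR: "\<forall>m\<in>{1..k}. vec.subspace (fst (PR m)) \<and>
      (\<forall>i\<in>{1..k} - {m}. vec.dim (fst (PR m)) = 2 \<and> E i (k + 2) ` fst (PR m) = snd (PR m) \<and>
        (\<forall>v\<in>fst (PR m). E m (k + 2) v \<in> snd (PR m) \<longrightarrow> v = 0))"
    by (rule bchoice[THEN exE])
  show ?thesis
  proof (intro exI conjI)
    show "\<forall>i\<in>{1..k}. linear_endo (*s) (E i (k + 2)) \<and> inj (E i (k + 2))"
      using linE inj by (intro ballI conjI)
  qed (rule PR)
qed

text \<open>
  The index \<open>k\<close> is spent on the reference map \<open>\<phi> k\<close>, which carries all the planes \<open>P m\<close> with
  \<open>m < k\<close> to \<open>R m\<close>; the bound for families of planes applies to the remaining \<open>k - 1\<close> indices.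
\<close>

theorem corollary1p3:
  fixes k :: nat
  assumes "k \<ge> 1"
    and "\<exists>C :: (nat \<Rightarrow> nat \<Rightarrow> 'a::{field,finite}) set. is_MSR_code (k + 2) k 4 C"
  shows "k \<le> 7"
proof -
  obtain C :: "(nat \<Rightarrow> nat \<Rightarrow> 'a) set" where C: "is_MSR_code (k + 2) k 4 C" using assms(2) by blast
  obtain \<phi> :: "nat \<Rightarrow> 'a ^ 4 \<Rightarrow> 'a ^ 4" and P R
    where \<phi>: "\<forall>i\<in>{1..k}. linear_endo (*s) (\<phi> i) \<and> inj (\<phi> i)"
      and fam: "\<forall>m\<in>{1..k}. vec.subspace (P m) \<and> (\<forall>i\<in>{1..k} - {m}. vec.dim (P m) = 2 \<and>
        \<phi> i ` P m = R m \<and> (\<forall>v\<in>P m. \<phi> m v \<in> R m \<longrightarrow> v = 0))"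
    using MSR_code_repair_family[OF C] by (elim exE conjE) (rule that)
  have repair: "vec.dim (P m) = 2" "\<phi> i ` P m = R m" "v \<in> P m \<Longrightarrow> \<phi> m v \<in> R m \<Longrightarrow> v = 0"
    if "m \<in> {1..k}" "i \<in> {1..k}" "i \<noteq> m" for i m v
    using fam that by blast+
  have kk: "k \<in> {1..k}" using assms(1) by simp
  have \<phi>k: "linear_endo (*s) (\<phi> k)" "inj (\<phi> k)" using \<phi> kk by blast+
  obtain \<psi> where \<psi>: "linear_endo (*s) \<psi>" "\<forall>v. \<psi> (\<phi> k v) = v" "\<forall>v. \<phi> k (\<psi> v) = v"
    using vec.linear_injective_isomorphism[OF \<phi>k refl] by (elim exE conjE) (rule that)
  have "card {1..<k} \<le> 6"
  proof (rule vec.MSR_family_card_le_6[where H = P and A = "\<lambda>i v. \<psi> (\<phi> i v)"])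
    fix i j assume ij: "i \<in> {1..<k}" "j \<in> {1..<k}" "i \<noteq> j"
    then have "\<phi> j ` P i = \<phi> k ` P i" using repair(2)[of i j] repair(2)[of i k] by simp
    then have "\<psi> ` \<phi> j ` P i = \<psi> ` \<phi> k ` P i" by simp
    then show "(\<lambda>v. \<psi> (\<phi> j v)) ` P i \<subseteq> P i" using \<psi>(2) by (simp add: image_image)
  next
    fix i v assume i: "i \<in> {1..<k}" and v: "v \<in> P i" "\<psi> (\<phi> i v) \<in> P i"
    have "\<phi> k (\<psi> (\<phi> i v)) \<in> \<phi> k ` P i" using v(2) by (rule imageI)
    then have "\<phi> i v \<in> R i" using \<psi>(3) repair(2)[of i k] i by simp
    then show "v = 0" using repair(3)[of i k v] i v(1) by simp
  next
    fix i assume i: "i \<in> {1..<k}"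
    show "vec.dim (P i) = 2" using repair(1)[of i k] i by simp
    show "vec.subspace (P i)" using fam i by simp
    have "linear_endo (*s) (\<phi> i)" using \<phi> i by simp
    then show "linear_endo (*s) (\<lambda>v. \<psi> (\<phi> i v))"
      using Vector_Spaces.linear_compose[of "(*s)" "(*s)" "\<phi> i" "(*s)" \<psi>] \<psi>(1) by (simp add: comp_def)
  qed (simp_all add: vec_dimension)
  then show ?thesis by simp
qed

end
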